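(* Let $(M,\rho)$ be a length metric space that is homeomorphic to the two-dimensional sphere $S^2$, and let $I:M\rightarrow M$ be an involutive isometry without fixed points (that is, $\rho(I(x),I(y))=\rho(x,y)$ for all $x,y\in M$, $I\circ I=\operatorname{Id}$, and $I(x)\neq x$ for all $x\in M$). Then there is a point $x\in M$ such that $\operatorname{diam}(M)=\rho(x,I(x))$, where $\operatorname{diam}(M)=\sup_{y,z\in M}\rho(y,z)$.
   Context: A metric space $(M,\rho)$ is called a length metric space (equivalently, the metric $\rho$ is intrinsic) if for every two points $x,y\in M$ the distance $\rho(x,y)$ equals the infimum of the lengths $l(\gamma)$ of all paths $\gamma$ in $M$ connecting $x$ and $y$. Here the length $l(\gamma)$ of a path is taken with respect to $\rho$, i.e. it is the supremum of $\sum_i \rho(\gamma(t_{i}),\gamma(t_{i+1}))$ over all finite partitions $t_0<t_1<\dots<t_k$ of the parameter interval. "Homeomorphic to $S^2$" refers to the topology on $M$ induced by $\rho$. A map $I:M\to M$ is an isometry if $\rho(I(x),I(y))=\rho(x,y)$ for all $x,y\in M$; it is involutive if $I\circ I=\operatorname{Id}$. The geodesic diameter of $(M,\rho)$ is $\operatorname{diam}(M)=\sup_{x,y\in M}\rho(x,y)$. *)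

theory Defs
  imports "HOL-Analysis.Analysis"
begin

text \<open>The length of a curve parametrized on the unit interval, the domain of the paths of
  \<^theory>\<open>HOL-Analysis.Path_Connected\<close>. It is extended-real valued, since a path need not be
  rectifiable.\<close>

definition curve_length :: "(real \<Rightarrow> 'a::metric_space) \<Rightarrow> ereal" where
  "curve_length g =
     (SUP (k, t) \<in> {(k :: nat, t :: nat \<Rightarrow> real). t 0 = 0 \<and> t k = 1 \<and> (\<forall>i<k. t i < t (Suc i))}.
        ereal (\<Sum>i<k. dist (g (t i)) (g (t (Suc i)))))"

text \<open>A metric space is represented by a set \<open>M\<close> with the restriction of \<^const>\<open>dist\<close>; only paths
  that stay inside \<open>M\<close> compete. The infimum is \<open>\<infinity>\<close> if there are no such paths, so that the
  condition entails path-connectedness.\<close>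

definition length_metric_space :: "'a::metric_space set \<Rightarrow> bool" where
  "length_metric_space M \<longleftrightarrow>
     (\<forall>x\<in>M. \<forall>y\<in>M.
        ereal (dist x y) =
          (INF g \<in> {g. path g \<and> path_image g \<subseteq> M \<and> pathstart g = x \<and> pathfinish g = y}.
             curve_length g))"

end

theory Submission
  imports Defs "HOL-Complex_Analysis.Complex_Analysis"
begin

text \<open>Let \<open>p, q\<close> realize the diameter \<open>D\<close>. Take almost shortest paths \<open>\<gamma>\<close> from \<open>p\<close> to \<open>I p\<close> and \<open>\<sigma>\<close>
  from \<open>q\<close> to \<open>I q\<close>. If \<open>\<gamma>\<close> meets \<open>\<sigma> \<union> I \<sigma>\<close> in a point \<open>z\<close>, then rerouting through \<open>z\<close> gives
  \<open>2 D \<le> d(p, q) + d(I p, I q) \<le> d(p, z) + d(z, q) + d(I p, z) + d(z, I q)\<close>, which is at most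
  \<open>d(p, I p) + d(q, I q) + \<epsilon>\<close>; hence both antipodal distances equal \<open>D\<close>.

  The paths do meet: otherwise puncture the sphere at \<open>p\<close>. An arc inside \<open>\<gamma>\<close> becomes an unbounded
  closed connected set \<open>L\<close> of the plane, whose complement has simply connected components. The
  displacement \<open>I x - x\<close>, read in the plane, therefore has a continuous logarithm on the connected
  invariant set \<open>\<sigma> \<union> I \<sigma>\<close>, which is impossible as it changes sign under \<open>I\<close>.\<close>

section \<open>Continuous logarithms in the plane\<close>

text \<open>As \<open>L\<close> is connected, the component of \<open>- L\<close> around
  \<open>K\<close> has a connected complement, which is unbounded because it contains
  \<open>L\<close>. Such a component is simply connected, so a nonvanishing function has a
  continuous logarithm on it.\<close>

lemma continuous_log_off_unbounded_connected:
  fixes L K :: "complex set" and f :: "complex \<Rightarrow> complex"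
  assumes "closed L" "connected L" "\<not> bounded L"
    and "connected K" "K \<subseteq> - L"
    and "continuous_on (- L) f" "\<And>z. z \<notin> L \<Longrightarrow> f z \<noteq> 0"
  obtains g where "continuous_on K g" "\<And>z. z \<in> K \<Longrightarrow> f z = exp (g z)"
proof (cases "K = {}")
  case True
  then show ?thesis using that by auto
next
  case False
  then obtain a where a: "a \<in> K" by auto
  define W where "W = connected_component_set (- L) a"
  have KW: "K \<subseteq> W"
    unfolding W_def using assms a by (intro connected_component_maximal) auto
  have W: "W \<in> components (- L)"
    unfolding W_def using a assms by (auto intro: componentsI)
  have WL: "W \<subseteq> - L" using W by (rule in_components_subset)
  have "open W" using W \<open>closed L\<close> by (metis open_Compl open_components)
  have "connected W" using W by (rule in_components_connected)
  have "connected (- W)"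
    using component_complement_connected[OF \<open>connected L\<close> W] .
  moreover have "L \<subseteq> - W" using WL by auto
  ultimately have "\<not> bounded C" if "C \<in> components (- W)" for C
    using that \<open>\<not> bounded L\<close> bounded_subset
    by (metis components_eq_sing_iff empty_iff singletonD components_empty)
  then have "simply_connected W"
    using simply_connected_eq_unbounded_complement_components \<open>open W\<close> \<open>connected W\<close> by blast
  then obtain g where "continuous_on W g" "\<And>z. z \<in> W \<Longrightarrow> f z = exp (g z)"
    using continuous_logarithm_on_simply_connected[of W f] assms WL \<open>open W\<close>
    by (metis ComplD continuous_on_subset open_imp_locally_path_connected subsetD)
  then show ?thesis
    using that KW by (meson continuous_on_subset subsetD)
qed

text \<open>\<open>l \<circ> f - l\<close> takes values in the odd multiples of \<open>\<i>\<pi>\<close>, so it is a constant \<open>c \<noteq> 0\<close>;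
  but \<open>f\<close> being an involution forces \<open>c = - c\<close>.\<close>

lemma involution_displacement_no_log:
  fixes B :: "'a::topological_space set" and \<phi> l :: "'a \<Rightarrow> complex"
  assumes "connected B" "x \<in> B"
    and f: "continuous_on B f" "f ` B \<subseteq> B" "\<And>x. x \<in> B \<Longrightarrow> f (f x) = x"
    and l: "continuous_on B l" "\<And>x. x \<in> B \<Longrightarrow> \<phi> (f x) - \<phi> x = exp (l x)"
  shows False
proof -
  define h where "h = (\<lambda>x. l (f x) - l x)"
  have h: "exp (h x) = - 1" if "x \<in> B" for x
  proof -
    have "exp (l (f x)) = - exp (l x)"
      using f l that by (metis image_subset_iff minus_diff_eq)
    then show ?thesis by (simp add: h_def exp_diff)
  qed
  have "continuous_on B h"
    unfolding h_def using f l
    by (intro continuous_intros continuous_on_compose2[of B l B f]) auto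
  moreover have "\<exists>e>0. \<forall>y. y \<in> B \<and> h y \<noteq> h x \<longrightarrow> e \<le> norm (h y - h x)" if "x \<in> B" for x
  \<comment> \<open>Solutions of \<open>exp w = - 1\<close> differ by integer multiples of
    2\<pi>\<i>, so distinct values of \<open>h\<close> are at least \<open>2 * pi\<close>
    apart.\<close>
  proof (intro exI[of _ "2 * pi"] conjI allI impI)
    fix y assume y: "y \<in> B \<and> h y \<noteq> h x"
    then have "exp (h y) = exp (h x)" using h that by auto
    then obtain n :: int where n: "h y = h x + (of_int (2 * n) * pi) * \<i>"
      using exp_eq[of "h y" "h x"] by auto
    then have "n \<noteq> 0" using y by auto
    have "norm (h y - h x) = 2 * pi * \<bar>real_of_int n\<bar>"
      using n by (simp add: norm_mult)
    moreover have "1 \<le> \<bar>real_of_int n\<bar>" using \<open>n \<noteq> 0\<close> by linarith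
    ultimately show "2 * pi \<le> norm (h y - h x)" by simp
  qed auto
  ultimately have "h constant_on B"
    using continuous_discrete_range_constant[OF \<open>connected B\<close>] by blast
  then have "h (f x) = h x"
    using \<open>x \<in> B\<close> f unfolding constant_on_def by (metis image_subset_iff)
  moreover have "h (f x) = - h x" using f \<open>x \<in> B\<close> by (simp add: h_def)
  ultimately have "h x = 0" by simp
  then show False using h[OF \<open>x \<in> B\<close>] by simp
qed

section \<open>Connected invariant sets on the sphere\<close>

text \<open>Stereographic projection; \<open>axis 1 1\<close> merely supplies a nonzero normal
  vector for the target plane, which has the same dimension 2 as the complex numbers.\<close>

lemma punctured_sphere_homeomorphic_complex:
  fixes p :: "real ^ 3"
  assumes "p \<in> sphere 0 1"
  shows "(sphere 0 1 - {p}) homeomorphic (UNIV :: complex set)"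
proof -
  let ?T = "{x :: real ^ 3. axis 1 1 \<bullet> x = 0}"
  have "axis 1 1 \<noteq> (0 :: real ^ 3)" by (simp add: axis_eq_0_iff)
  then have "(sphere 0 1 - {p}) homeomorphic ?T"
    using assms by (intro homeomorphic_punctured_sphere_hyperplane) auto
  also have "?T homeomorphic (UNIV :: complex set)"
    using \<open>axis 1 1 \<noteq> 0\<close> by (subst homeomorphic_affine_sets_eq) (auto simp: affine_hyperplane)
  finally show ?thesis .
qed

text \<open>Puncturing at the start \<open>p\<close> of the arc makes it run to infinity in the
  plane. Its other end \<open>f p\<close> is the only point that \<open>f\<close> sends to the
  puncture, so off the arc the planar displacement is defined; it has no zero since \<open>f\<close>
  has no fixed point.\<close>

lemma arc_meets_invariant_connected_set:
  fixes f :: "real ^ 3 \<Rightarrow> real ^ 3" and g :: "real \<Rightarrow> real ^ 3"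
  defines "S \<equiv> sphere 0 1"
  assumes f: "continuous_on S f" "f ` S \<subseteq> S"
    "\<And>x. x \<in> S \<Longrightarrow> f (f x) = x" "\<And>x. x \<in> S \<Longrightarrow> f x \<noteq> x"
    and g: "arc g" "path_image g \<subseteq> S" "pathfinish g = f (pathstart g)"
    and B: "connected B" "B \<subseteq> S" "B \<noteq> {}" "f ` B \<subseteq> B"
  shows "B \<inter> path_image g \<noteq> {}"
proof
  assume disj: "B \<inter> path_image g = {}"
  define p where "p = pathstart g"
  have p: "p \<in> path_image g" "f p \<in> path_image g" "p \<in> S"
    using g by (auto simp: p_def) (metis pathfinish_in_path_image)
  obtain \<phi> \<psi> where "homeomorphism (S - {p}) (UNIV :: complex set) \<phi> \<psi>"
    using punctured_sphere_homeomorphic_complex p unfolding S_def homeomorphic_def by blast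
  then have \<phi>: "continuous_on (S - {p}) \<phi>" "\<And>x. x \<in> S - {p} \<Longrightarrow> \<psi> (\<phi> x) = x"
    and \<psi>: "continuous_on UNIV \<psi>" "\<And>z. \<psi> z \<in> S - {p}" "\<And>z. \<phi> (\<psi> z) = z"
    unfolding homeomorphism_def by auto
  define L where "L = \<phi> ` (path_image g - {p})"
  have memL: "z \<in> L \<longleftrightarrow> \<psi> z \<in> path_image g" for z
  proof
    assume "z \<in> L"
    then obtain x where x: "x \<in> path_image g" "x \<noteq> p" "z = \<phi> x" by (auto simp: L_def)
    then have "\<psi> z = x" using \<phi>(2) g(2) by blast
    then show "\<psi> z \<in> path_image g" using x by simp
  next
    show "\<psi> z \<in> path_image g \<Longrightarrow> z \<in> L"
      using \<psi>(2,3)[of z] unfolding L_def by (metis DiffD2 DiffI imageI)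
  qed
  have image_L: "\<psi> ` L = path_image g - {p}"
    unfolding L_def image_image using \<phi>(2) g(2) by force
  have fne: "f (\<psi> z) \<in> S - {p}" if "z \<notin> L" for z
  proof -
    have "\<psi> z \<noteq> f p" using that memL p by auto
    then show ?thesis using f \<psi>(2)[of z] by auto
  qed
  have closed_g: "closed (path_image g)"
    using g(1) by (simp add: arc_imp_path closed_path_image)
  have "closed L"
  proof -
    have "L = \<psi> -` path_image g" using memL by auto
    then show ?thesis
      using closed_g \<psi>(1) by (simp add: continuous_closed_vimage continuous_on_eq_continuous_at)
  qed
  moreover have "connected L"
  proof -
    \<comment> \<open>Injectivity of the arc matters here: deleting \<open>p\<close> removes the
      parameter 0 only, and a half-open interval remains.\<close>
    have "path_image g - {p} = g ` {0<..1}"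
    proof -
      have inj: "inj_on g {0..1}" using g(1) by (simp add: arc_def)
      have "{0..1} - {0} = {0<..1::real}" "{0<..1} \<subseteq> {0..1::real}" by auto
      then show ?thesis
        using inj_on_image_set_diff[OF inj, of "{0..1}" "{0}"]
        by (simp add: path_image_def p_def pathstart_def)
    qed
    moreover have "continuous_on {0<..1} g"
      using g(1) by (auto simp: arc_def path_def elim: continuous_on_subset)
    ultimately have "connected (path_image g - {p})"
      by (simp add: connected_continuous_image)
    then show ?thesis
      unfolding L_def using g(2)
      by (intro connected_continuous_image continuous_on_subset[OF \<phi>(1)]) auto
  qed
  \<comment> \<open>If \<open>L\<close> were compact, then so would be the arc without
    \<open>p\<close>, and the connected arc would split into two disjoint nonempty closed sets, one
    of them \<open>{p}\<close>.\<close>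
  moreover have "\<not> bounded L"
  proof
    assume "bounded L"
    then have "compact L" using \<open>closed L\<close> compact_eq_bounded_closed by blast
    then have "closed (path_image g - {p})"
      using image_L \<psi>(1)
      by (metis compact_continuous_image compact_imp_closed continuous_on_subset subset_UNIV)
    moreover have "connected (path_image g)"
      using g(1) by (simp add: arc_imp_path connected_path_image)
    moreover have "path_image g \<inter> (path_image g - {p}) \<noteq> {}" using p f(4) by blast
    ultimately show False
      using connected_closedD[of "path_image g" "{p}" "path_image g - {p}"] p by auto
  qed
  moreover have "connected (\<phi> ` B)"
    using B disj p by (intro connected_continuous_image continuous_on_subset[OF \<phi>(1)]) auto
  moreover have "\<phi> ` B \<subseteq> - L"
    using B disj p memL \<phi>(2) by force
  moreover have "continuous_on (- L) (\<lambda>z. \<phi> (f (\<psi> z)) - z)"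
  proof (intro continuous_intros continuous_on_compose2[OF \<phi>(1)] continuous_on_compose2[OF f(1)])
    show "continuous_on (- L) \<psi>" using \<psi>(1) continuous_on_subset by blast
  qed (use \<psi>(2) fne in auto)
  moreover have "\<phi> (f (\<psi> z)) - z \<noteq> 0" if "z \<notin> L" for z
    using fne[OF that] \<psi>(2)[of z] \<phi>(2) f(4) by (metis DiffD1 eq_iff_diff_eq_0)
  ultimately obtain l where l: "continuous_on (\<phi> ` B) l"
    "\<And>z. z \<in> \<phi> ` B \<Longrightarrow> \<phi> (f (\<psi> z)) - z = exp (l z)"
    using continuous_log_off_unbounded_connected[of L "\<phi> ` B" "\<lambda>z. \<phi> (f (\<psi> z)) - z"] by blast
  obtain x where x: "x \<in> B" using B by auto
  show False
  proof (rule involution_displacement_no_log[of B x f "\<lambda>x. l (\<phi> x)" \<phi>])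
    have "continuous_on B \<phi>" using B disj p by (intro continuous_on_subset[OF \<phi>(1)]) auto
    then show "continuous_on B (\<lambda>x. l (\<phi> x))"
      by (intro continuous_on_compose2[OF l(1)]) auto
    show "\<phi> (f x) - \<phi> x = exp (l (\<phi> x))" if "x \<in> B" for x
    proof -
      have "x \<in> S - {p}" using that B disj p by auto
      then show ?thesis using l(2)[of "\<phi> x"] \<phi>(2) that by simp
    qed
  qed (use B f x continuous_on_subset[OF f(1) B(2)] in auto)
qed

text \<open>Everything is conjugated to the sphere by a homeomorphism. There the path contains an
  arc with the same endpoints, which are distinct because \<open>I\<close> has no fixed
  point.\<close>

lemma path_meets_invariant_connected_set:
  fixes M :: "'a::t2_space set"
  assumes "M homeomorphic sphere (0 :: real ^ 3) 1"
    and I: "continuous_on M I" "I ` M \<subseteq> M" "\<And>x. x \<in> M \<Longrightarrow> I (I x) = x" "\<And>x. x \<in> M \<Longrightarrow> I x \<noteq> x"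
    and g: "path g" "path_image g \<subseteq> M" "pathfinish g = I (pathstart g)"
    and B: "connected B" "B \<subseteq> M" "B \<noteq> {}" "I ` B \<subseteq> B"
  shows "B \<inter> path_image g \<noteq> {}"
proof -
  let ?S = "sphere (0 :: real ^ 3) 1"
  obtain h k where "homeomorphism M ?S h k"
    using assms(1) unfolding homeomorphic_def by blast
  then have h: "continuous_on M h" "h ` M = ?S" "\<And>x. x \<in> M \<Longrightarrow> k (h x) = x"
    and k: "continuous_on ?S k" "k ` ?S = M" "\<And>y. y \<in> ?S \<Longrightarrow> h (k y) = y"
    unfolding homeomorphism_def by auto
  define f where "f = (\<lambda>y. h (I (k y)))"
  have fh: "f (h x) = h (I x)" if "x \<in> M" for x
    using that h by (simp add: f_def)
  have f: "continuous_on ?S f" "f ` ?S \<subseteq> ?S"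
    "\<And>y. y \<in> ?S \<Longrightarrow> f (f y) = y" "\<And>y. y \<in> ?S \<Longrightarrow> f y \<noteq> y"
  proof -
    show "continuous_on ?S f"
      unfolding f_def
      by (intro continuous_on_compose2[OF h(1)] continuous_on_compose2[OF I(1)] k(1))
        (use I(2) k(2) in auto)
    show "f ` ?S \<subseteq> ?S"
      unfolding f_def using I(2) h(2) k(2) by blast
    show "f (f y) = y" "f y \<noteq> y" if "y \<in> ?S" for y
    proof -
      obtain x where x: "x \<in> M" "y = h x" using \<open>y \<in> ?S\<close> h(2) by blast
      then have "I x \<in> M" using I(2) by auto
      then show "f (f y) = y" "f y \<noteq> y" using x fh I(3,4) h(3) by metis+
    qed
  qed
  have start: "pathstart g \<in> M" using g(2) by auto
  have "path (h \<circ> g)"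
    using g h(1) continuous_on_subset by (intro path_continuous_image) blast+
  moreover have ends: "pathstart (h \<circ> g) = h (pathstart g)" "pathfinish (h \<circ> g) = f (h (pathstart g))"
    using g(3) fh[OF start] by (auto simp: pathstart_def pathfinish_def)
  moreover have "h (pathstart g) \<noteq> f (h (pathstart g))" using f(4) h(2) start by force
  ultimately obtain a where a: "arc a" "path_image a \<subseteq> path_image (h \<circ> g)"
    "pathstart a = h (pathstart g)" "pathfinish a = f (h (pathstart g))"
    by (metis path_contains_arc)
  have "h ` B \<inter> path_image a \<noteq> {}"
  proof (rule arc_meets_invariant_connected_set[OF f a(1)])
    show "path_image a \<subseteq> ?S"
      using a(2) g(2) h(2) by (force simp: path_image_compose)
    show "connected (h ` B)"
      using B h(1) by (meson connected_continuous_image continuous_on_subset)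
    show "h ` B \<subseteq> ?S" using B h(2) by blast
    show "f ` h ` B \<subseteq> h ` B" using B fh by force
  qed (use a B in auto)
  then obtain x y where "x \<in> B" "y \<in> path_image g" "h x = h y"
    using a(2) unfolding path_image_compose by blast
  moreover have "x \<in> M" "y \<in> M" using calculation B(2) g(2) by auto
  ultimately have "x = y" using h(3) by metis
  then show ?thesis using \<open>x \<in> B\<close> \<open>y \<in> path_image g\<close> by auto
qed

section \<open>Lengths and almost shortest paths\<close>

text \<open>The partition 0 < s < 1 with \<open>z = g s\<close> gives the bound. Partitions are
  strictly increasing, so an endpoint \<open>z\<close> needs the one-interval partition
  instead.\<close>

lemma dist_via_le_curve_length:
  assumes "z \<in> path_image g"
  shows "ereal (dist (pathstart g) z + dist z (pathfinish g)) \<le> curve_length g"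
proof -
  have upper: "ereal (\<Sum>i<k. dist (g (t i)) (g (t (Suc i)))) \<le> curve_length g"
    if "t 0 = 0" "t k = 1" "\<forall>i<k. t i < t (Suc i)" for k :: nat and t :: "nat \<Rightarrow> real"
    unfolding curve_length_def using that by (intro SUP_upper2[of "(k, t)"]) auto
  obtain s where s: "s \<in> {0..1}" "z = g s" using assms by (auto simp: path_image_def)
  consider "s = 0 \<or> s = 1" | "0 < s" "s < 1" using s by fastforce
  then show ?thesis
  proof cases
    case 1
    then show ?thesis
      using upper[of "\<lambda>i. real i" 1] s by (auto simp: pathstart_def pathfinish_def)
  next
    case 2
    then show ?thesis
      using upper[of "\<lambda>i. if i = 0 then 0 else if i = 1 then s else 1" 2] s
      by (auto simp: pathstart_def pathfinish_def numeral_2_eq_2 less_Suc_eq)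
  qed
qed

lemma length_metric_space_near_geodesic:
  assumes "length_metric_space M" "x \<in> M" "y \<in> M" "0 < e"
  obtains g where "path g" "path_image g \<subseteq> M" "pathstart g = x" "pathfinish g = y"
    "\<And>z. z \<in> path_image g \<Longrightarrow> dist x z + dist z y < dist x y + e"
proof -
  let ?P = "{g. path g \<and> path_image g \<subseteq> M \<and> pathstart g = x \<and> pathfinish g = y}"
  have "(INF g \<in> ?P. curve_length g) = ereal (dist x y)"
    using assms(1-3) by (simp add: length_metric_space_def)
  also have "\<dots> < ereal (dist x y + e)" using assms by simp
  finally obtain g where g: "g \<in> ?P" "curve_length g < ereal (dist x y + e)"
    unfolding INF_less_iff by blast
  have "dist x z + dist z y < dist x y + e" if "z \<in> path_image g" for z
  proof -
    have "ereal (dist x z + dist z y) \<le> curve_length g"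
      using dist_via_le_curve_length[OF that] g(1) by auto
    then show ?thesis using g(2) using le_less_trans less_ereal.simps(1) by blast
  qed
  then show ?thesis using that g(1) by blast
qed

section \<open>Rerouting through a crossing point\<close>

theorem theorem1:
  fixes M :: "'a::metric_space set" and I :: "'a \<Rightarrow> 'a"
  assumes "length_metric_space M"
    and "M homeomorphic sphere (0 :: real ^ 3) 1"
    and "I \<in> M \<rightarrow> M"
    and "\<forall>x\<in>M. \<forall>y\<in>M. dist (I x) (I y) = dist x y"
    and "\<forall>x\<in>M. I (I x) = x"
    and "\<forall>x\<in>M. I x \<noteq> x"
  shows "\<exists>x\<in>M. diameter M = dist x (I x)"
proof -
  note iso = assms(4)[rule_format] and inv = assms(5)[rule_format]
  have IM: "I x \<in> M" if "x \<in> M" for x using assms(3) that by auto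
  have "compact M" using assms(2) homeomorphic_compactness compact_sphere by blast
  have "sphere (0 :: real ^ 3) 1 \<noteq> {}" by simp
  then have "M \<noteq> {}" using assms(2) homeomorphic_empty by blast
  obtain p q where pq: "p \<in> M" "q \<in> M" "dist p q = diameter M"
    using diameter_compact_attained[OF \<open>compact M\<close> \<open>M \<noteq> {}\<close>] by blast
  have contI: "continuous_on M I"
    unfolding continuous_on_iff using iso by metis
  have "2 * diameter M \<le> dist p (I p) + dist q (I q) + e" if e: "0 < e" for e
  proof -
    obtain g where g: "path g" "path_image g \<subseteq> M" "pathstart g = p" "pathfinish g = I p"
      "\<And>z. z \<in> path_image g \<Longrightarrow> dist p z + dist z (I p) < dist p (I p) + e / 2"
      using length_metric_space_near_geodesic[OF assms(1) pq(1) IM[OF pq(1)] half_gt_zero[OF e]]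
      by blast
    obtain s where s: "path s" "path_image s \<subseteq> M" "pathstart s = q" "pathfinish s = I q"
      "\<And>z. z \<in> path_image s \<Longrightarrow> dist q z + dist z (I q) < dist q (I q) + e / 2"
      using length_metric_space_near_geodesic[OF assms(1) pq(2) IM[OF pq(2)] half_gt_zero[OF e]]
      by blast
    \<comment> \<open>Adding the mirror image makes the set invariant; it stays connected because
      both halves contain \<open>I q\<close>.\<close>
    define B where "B = path_image s \<union> I ` path_image s"
    have "q \<in> path_image s" "I q \<in> path_image s"
      using s(3,4) pathstart_in_path_image pathfinish_in_path_image by metis+
    then have "path_image s \<inter> I ` path_image s \<noteq> {}" by blast
    moreover have "connected (path_image s)" using s(1) by (rule connected_path_image)
    moreover have "connected (I ` path_image s)"
      using contI s(1,2) by (meson connected_continuous_image connected_path_image continuous_on_subset)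
    ultimately have "connected B" unfolding B_def by (intro connected_Un)
    moreover have "B \<subseteq> M" "B \<noteq> {}" using s(2) IM \<open>q \<in> path_image s\<close> by (auto simp: B_def)
    moreover have "I ` B \<subseteq> B" using s(2) inv by (force simp: B_def)
    ultimately have "B \<inter> path_image g \<noteq> {}"
      using assms(2,6) contI IM inv g
      by (intro path_meets_invariant_connected_set[of M I]) auto
    then obtain z where z: "z \<in> B" "z \<in> path_image g" by auto
    then have "z \<in> M" using \<open>B \<subseteq> M\<close> by auto
    have zs: "dist q z + dist z (I q) < dist q (I q) + e / 2"
    proof (cases "z \<in> path_image s")
      case True
      then show ?thesis by (rule s(5))
    next
      case False
      \<comment> \<open>Applying \<open>I\<close> swaps \<open>q\<close> and \<open>I q\<close>, so
        the sum of the distances to them is the same from \<open>w\<close> as from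
        \<open>z\<close>.\<close>
      then obtain w where w: "w \<in> path_image s" "z = I w" using z by (auto simp: B_def)
      then have "w \<in> M" using s(2) by auto
      then have "dist z (I q) = dist q w" "dist q z = dist w (I q)"
        using w iso[of w q] iso[of "I q" w] inv pq IM by (simp_all add: dist_commute)
      then show ?thesis using s(5)[OF w(1)] by simp
    qed
    \<comment> \<open>Both \<open>dist p q\<close> and \<open>dist (I p) (I q)\<close> equal the
      diameter; each is bounded by a detour through \<open>z\<close>, and the four terms regroup
      along the two paths.\<close>
    have "diameter M \<le> dist p z + dist q z" using pq dist_triangle2 by metis
    moreover have "diameter M \<le> dist z (I p) + dist z (I q)"
      using pq iso dist_triangle3 by metis
    ultimately show ?thesis using g(5)[OF z(2)] zs by linarith
  qed
  then have "2 * diameter M \<le> dist p (I p) + dist q (I q)" by (rule field_le_epsilon)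
  moreover have "dist q (I q) \<le> diameter M" "dist p (I p) \<le> diameter M"
    using \<open>compact M\<close> pq IM by (auto intro: diameter_bounded_bound compact_imp_bounded)
  \<comment> \<open>Two numbers that are at most the diameter and add up to at least twice the
    diameter both equal it.\<close>
  ultimately show ?thesis using pq(1) by (intro bexI[of _ p]) linarith+
qed

end
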